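(* Let $n$ be a positive integer. The following hold: (1) $\Gamma(\mathbf{S}_n)$ is a divisor graph if and only if $n\le 7$; (2) $\Gamma(\mathbf{A}_n)$ is a divisor graph if and only if $n\le 8$.
   Context: $\mathbf{S}_n$ and $\mathbf{A}_n$ are the symmetric and alternating groups of degree $n$. The coprime graph $\Gamma(G)$ of a finite group $G$ is the simple undirected graph with vertex set $G$ in which two distinct vertices $x,y$ are adjacent if and only if $\gcd(o(x),o(y))=1$, where $o(x)$ is the order of $x$. A simple undirected graph $\Gamma$ is a divisor graph if there is an injection $\alpha$ from $V(\Gamma)$ to the set of positive integers such that distinct $x,y\in V(\Gamma)$ are adjacent if and only if $\alpha(x)\mid\alpha(y)$ or $\alpha(y)\mid\alpha(x)$. *)

theory Defs
  imports "HOL-Algebra.Sym_Groups" "HOL-Algebra.Multiplicative_Group" "Graph_Theory.Pair_Digraph"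
begin

text \<open>
  A simple undirected graph is a symmetric loop-free pair digraph: the edge between \<open>x\<close> and \<open>y\<close>
  is the pair of arcs \<open>(x, y)\<close>, \<open>(y, x)\<close>.
\<close>

definition coprime_graph :: "('a, 'b) monoid_scheme \<Rightarrow> 'a pair_pre_digraph" where
  "coprime_graph G =
    \<lparr> pverts = carrier G,
      parcs = {(x, y). x \<in> carrier G \<and> y \<in> carrier G \<and> x \<noteq> y \<and>
                       gcd (group.ord G x) (group.ord G y) = 1} \<rparr>"

definition divisor_graph :: "'a pair_pre_digraph \<Rightarrow> bool" where
  "divisor_graph \<Gamma> \<longleftrightarrow>
    pair_bidirected_digraph \<Gamma> \<and>
    (\<exists>\<alpha> :: 'a \<Rightarrow> nat.
       inj_on \<alpha> (pverts \<Gamma>) \<and> (\<forall>x \<in> pverts \<Gamma>. \<alpha> x > 0) \<and>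
       (\<forall>x \<in> pverts \<Gamma>. \<forall>y \<in> pverts \<Gamma>. x \<noteq> y \<longrightarrow>
          ((x, y) \<in> parcs \<Gamma> \<longleftrightarrow> \<alpha> x dvd \<alpha> y \<or> \<alpha> y dvd \<alpha> x)))"

lemma pair_bidirected_coprime_graph: "pair_bidirected_digraph (coprime_graph G)"
  by unfold_locales
    (auto simp: coprime_graph_def symmetric_def arcs_ends_def arc_to_ends_def gcd.commute intro!: symI)

end

theory Submission
  imports Defs "HOL-Computational_Algebra.Primes"
begin

text \<open>
  On positive integers, divisibility is a partial order, and every finite partial order is
  realised by it (label each element by the product of distinct primes attached to the elements
  below it). Hence a finite graph is a divisor graph exactly when it is the comparability graph
  of some order on its vertices.

  In a coprime graph only the sets of primes dividing the element orders matter; record which pairs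
  of primes occur together by the graph on the primes that joins \<open>q\<close> and \<open>r\<close> whenever some element
  has order divisible by \<open>q * r\<close>. Two observations about this graph settle all cases.

  \<^item> If all its edges lie on a path \<open>a - b - c\<close>, the coprime graph can be ordered by a rank: after
    the identity, put the elements of order divisible by \<open>a\<close>, then those of order a power of \<open>b\<close>,
    then those of order divisible by \<open>c\<close>, and treat the powers of every other prime as one further level each
    (\<open>divisor_graph_if_prime_graph_path\<close>).

  \<^item> If it has a triangle, given by elements of order \<open>p * q\<close>, \<open>p * r\<close>, \<open>q * r\<close>, then together with
    elements of orders \<open>p\<close>, \<open>q\<close>, \<open>r\<close> they induce a triangle with a pendant vertex at each corner.
    In a comparability graph each corner would have to be minimal or maximal among its neighbours,
    which is impossible for the middle one of three comparable elements
    (\<open>not_divisor_graph_if_prime_graph_triangle\<close>).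

  A permutation of degree \<open>n\<close> whose order is divisible by distinct primes \<open>q\<close> and \<open>r\<close> has disjoint
  cycles of lengths divisible by \<open>q\<close> and by \<open>r\<close>, or one cycle of length divisible by
  \<open>q * r \<ge> q + r\<close>; in both cases \<open>q + r \<le> n\<close> (\<open>add_primes_le_degree\<close>). For \<open>n \<le> 7\<close> this leaves
  only the pairs \<open>{2, 3}\<close> and \<open>{2, 5}\<close>. For \<open>n = 8\<close> the pair \<open>{3, 5}\<close> joins them, but in the
  alternating group \<open>{2, 5}\<close> disappears, because an element of order divisible by \<open>10\<close> would be the product of a
  \<open>5\<close>-cycle and one transposition, hence odd (\<open>no_order_10_in_alt_group_8\<close>). The symmetric
  group of degree \<open>8\<close> and the alternating group of degree \<open>9\<close> do contain elements of orders
  \<open>6\<close>, \<open>10\<close> and \<open>15\<close>, and so do all those of larger degree.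
\<close>

section \<open>Divisor labellings of finite orders\<close>

text \<open>
  Attach distinct primes to the elements of \<open>V\<close>. The product of the primes attached to the down-set
  of \<open>x\<close> is squarefree, so divisibility of these products is inclusion of down-sets, which is the
  given order.
\<close>

lemma divisor_labelling_of_order:
  fixes le :: "'a \<Rightarrow> 'a \<Rightarrow> bool"
  assumes fin: "finite V"
    and refl: "\<And>x. x \<in> V \<Longrightarrow> le x x"
    and antisym: "\<And>x y. x \<in> V \<Longrightarrow> y \<in> V \<Longrightarrow> le x y \<Longrightarrow> le y x \<Longrightarrow> x = y"
    and trans: "\<And>x y z. x \<in> V \<Longrightarrow> y \<in> V \<Longrightarrow> z \<in> V \<Longrightarrow> le x y \<Longrightarrow> le y z \<Longrightarrow> le x z"
  obtains \<alpha> :: "'a \<Rightarrow> nat"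
  where "inj_on \<alpha> V" "\<And>x. \<alpha> x > 0" "\<And>x y. x \<in> V \<Longrightarrow> y \<in> V \<Longrightarrow> \<alpha> x dvd \<alpha> y \<longleftrightarrow> le x y"
proof -
  obtain f :: "'a \<Rightarrow> nat" where f: "inj_on f V"
    using finite_imp_inj_to_nat_seg[OF fin] by blast
  define e where "e = enumerate {p::nat. prime p} \<circ> f"
  have e_inj: "inj_on e V"
    unfolding e_def using f inj_enumerate[OF primes_infinite]
    by (simp add: comp_inj_on inj_on_subset[OF _ subset_UNIV])
  have e_prime: "prime (e x)" for x
    unfolding e_def using enumerate_in_set[OF primes_infinite] by simp
  define \<alpha> where "\<alpha> x = \<Prod>(e ` {z \<in> V. le z x})" for x
  have pos: "\<alpha> x > 0" for x
    unfolding \<alpha>_def using prime_gt_0_nat[OF e_prime] by (auto intro: prod_pos)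
  have dvd: "\<alpha> x dvd \<alpha> y \<longleftrightarrow> le x y" if xy: "x \<in> V" "y \<in> V" for x y
  proof
    assume "\<alpha> x dvd \<alpha> y"
    moreover have "e x dvd \<alpha> x"
      unfolding \<alpha>_def by (rule dvd_prod_eqI[where a = "e x"]) (use fin xy refl in auto)
    ultimately have "e x dvd \<Prod>(e ` {z \<in> V. le z y})"
      unfolding \<alpha>_def by (rule dvd_trans[rotated])
    then obtain z where "z \<in> V" "le z y" "e x dvd e z"
      using fin e_prime[of x] by (auto simp: prime_dvd_prod_iff)
    then have "e x = e z" using e_prime by (simp add: primes_dvd_imp_eq)
    then have "x = z" using e_inj xy \<open>z \<in> V\<close> by (auto dest: inj_onD)
    then show "le x y" using \<open>le z y\<close> by simp
  next
    assume "le x y"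
    then have "{z \<in> V. le z x} \<subseteq> {z \<in> V. le z y}" using xy trans by blast
    then show "\<alpha> x dvd \<alpha> y"
      unfolding \<alpha>_def using fin by (intro prod_dvd_prod_subset) auto
  qed
  have "inj_on \<alpha> V"
    by (rule inj_onI) (metis antisym dvd dvd_refl)
  then show thesis using pos dvd that by blast
qed


section \<open>Coprime graphs and prime divisors of element orders\<close>

lemma divisor_graph_coprime_graph_iff:
  "divisor_graph (coprime_graph G) \<longleftrightarrow>
    (\<exists>\<alpha> :: 'a \<Rightarrow> nat. inj_on \<alpha> (carrier G) \<and> (\<forall>x \<in> carrier G. \<alpha> x > 0) \<and>
      (\<forall>x \<in> carrier G. \<forall>y \<in> carrier G. x \<noteq> y \<longrightarrow>
        (coprime (group.ord G x) (group.ord G y) \<longleftrightarrow> \<alpha> x dvd \<alpha> y \<or> \<alpha> y dvd \<alpha> x)))"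
  for G :: "('a, 'b) monoid_scheme"
proof -
  have "(x, y) \<in> parcs (coprime_graph G) \<longleftrightarrow> coprime (group.ord G x) (group.ord G y)"
    if "x \<in> carrier G" "y \<in> carrier G" "x \<noteq> y" for x y
    using that by (simp add: coprime_graph_def coprime_iff_gcd_eq_1)
  moreover have "pverts (coprime_graph G) = carrier G"
    by (simp add: coprime_graph_def)
  ultimately show ?thesis
    unfolding divisor_graph_def using pair_bidirected_coprime_graph[of G] by simp
qed

text \<open>
  The path condition excludes orders divisible by \<open>a * c\<close> and forces the order of an element to be a
  prime power as soon as a prime outside the path divides it. Orient every edge of the coprime graph
  from the smaller to the larger rank. Transitivity can fail along \<open>x\<close>, \<open>y\<close>, \<open>z\<close> only through a
  prime shared by the orders of \<open>x\<close> and \<open>z\<close>. A prime other than \<open>b\<close> determines the rank, so the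
  shared prime is \<open>b\<close>; then \<open>y\<close> is squeezed onto the level of \<open>b\<close>, and its order is not coprime to
  that of \<open>x\<close>.
\<close>

theorem divisor_graph_if_prime_graph_path:
  fixes G :: "('a, 'b) monoid_scheme" and a b c :: nat
  assumes G: "group G" and fin: "finite (carrier G)"
    and primes: "prime a" "prime b" "prime c" and neq: "a \<noteq> b" "b \<noteq> c" "a \<noteq> c"
    and path: "\<And>x q r. x \<in> carrier G \<Longrightarrow> prime q \<Longrightarrow> prime r \<Longrightarrow> q \<noteq> r \<Longrightarrow>
      q dvd group.ord G x \<Longrightarrow> r dvd group.ord G x \<Longrightarrow> {q, r} = {a, b} \<or> {q, r} = {b, c}"
  shows "divisor_graph (coprime_graph G)"
proof -
  interpret group G by fact
  define rank where "rank x =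
    (if ord x = 1 then 0 else if a dvd ord x then 1 else if c dvd ord x then 3
     else if b dvd ord x then 2 else 4 + (LEAST q. prime q \<and> q dvd ord x))" for x
  have not_one: "ord x \<noteq> 1" if "prime q" "q dvd ord x" for x and q :: nat
    using that by auto
  have not_ac: "\<not> (a dvd ord x \<and> c dvd ord x)" if "x \<in> carrier G" for x
    using path[OF that primes(1) primes(3)] neq by (auto simp: doubleton_eq_iff)
  have rank_a: "rank x = 1" if "a dvd ord x" for x
    using that not_one[OF primes(1) that] by (simp add: rank_def)
  have rank_c: "rank x = 3" if "x \<in> carrier G" "c dvd ord x" for x
    using that not_one[OF primes(3) that(2)] not_ac[OF that(1)] by (simp add: rank_def)
  have rank_b: "rank x \<in> {1, 2, 3}" if "b dvd ord x" for x
    using that not_one[OF primes(2) that] by (simp add: rank_def)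
  have rank_2: "b dvd ord x" if "rank x = 2" for x
    using that by (simp add: rank_def split: if_splits)
  have rank_q: "rank x = 4 + q"
    if x: "x \<in> carrier G" and q: "prime q" "q dvd ord x" "q \<notin> {a, b, c}" for x and q :: nat
  proof -
    have only: "r = q" if "prime r" "r dvd ord x" for r
      using path[OF x q(1) that(1) _ q(2) that(2)] q(3) by (auto simp: doubleton_eq_iff)
    have "(LEAST q. prime q \<and> q dvd ord x) = q"
      by (rule Least_equality) (simp add: q, metis only order_refl)
    moreover have "\<not> a dvd ord x" "\<not> b dvd ord x" "\<not> c dvd ord x"
      using only primes q(3) by blast+
    ultimately show ?thesis using not_one[OF q(1,2)] by (simp add: rank_def)
  qed
  \<comment> \<open>Every prime except the middle \<open>b\<close> of the path determines the rank of the elements whose order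
    it divides.\<close>
  have rank_eq: "rank x = rank y"
    if prem: "x \<in> carrier G" "y \<in> carrier G" "prime q" "q \<noteq> b" "q dvd ord x" "q dvd ord y"
    for x y q
  proof -
    consider "q = a" | "q = c" | "q \<notin> {a, b, c}" using prem(4) by blast
    then show ?thesis
    proof cases
      case 1
      then show ?thesis using prem rank_a by metis
    next
      case 2
      then show ?thesis using prem rank_c by metis
    next
      case 3
      then show ?thesis using prem rank_q by metis
    qed
  qed
  have rank_neq: "rank x \<noteq> rank y"
    if xy: "x \<in> carrier G" "y \<in> carrier G" "x \<noteq> y" and cop: "coprime (ord x) (ord y)" for x y
  proof
    assume eq: "rank x = rank y"
    have ndvd: "\<not> (q dvd ord x \<and> q dvd ord y)" if "prime q" for q :: nat
      using cop that by (metis coprime_common_divisor not_prime_unit)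
    have ex: "ord z = 1 \<or> (\<exists>q. prime q \<and> q dvd ord z)" for z
      using prime_factor_nat by blast
    have cases: "ord z = 1 \<and> rank z = 0 \<or> a dvd ord z \<and> rank z = 1 \<or> c dvd ord z \<and> rank z = 3
        \<or> b dvd ord z \<and> rank z = 2 \<or> (\<exists>q. prime q \<and> q dvd ord z \<and> rank z = 4 + q)"
      if z: "z \<in> carrier G" for z
    proof (cases "ord z = 1 \<or> a dvd ord z \<or> c dvd ord z \<or> b dvd ord z")
      case True
      then show ?thesis by (auto simp: rank_def)
    next
      case False
      then obtain q where "prime q" "q dvd ord z" using ex by blast
      with False rank_q[OF z] show ?thesis by blast
    qed
    have "ord x = 1 \<and> ord y = 1"
      using cases[OF xy(1)] cases[OF xy(2)] eq ndvd primes by auto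
    then show False using xy ord_eq_1 by auto
  qed
  define le where "le x y \<longleftrightarrow> x = y \<or> coprime (ord x) (ord y) \<and> rank x < rank y" for x y
  have le_refl: "le x x" for x
    by (simp add: le_def)
  have le_antisym: "x = y" if "le x y" "le y x" for x y
    using that by (auto simp: le_def)
  have le_trans: "le x z"
    if xyz: "x \<in> carrier G" "y \<in> carrier G" "z \<in> carrier G" and "le x y" "le y z" for x y z
  proof (cases "x = y \<or> y = z")
    case True
    then show ?thesis using that by auto
  next
    case False
    with that have cop: "coprime (ord x) (ord y)" "coprime (ord y) (ord z)"
      and less: "rank x < rank y" "rank y < rank z"
      by (auto simp: le_def)
    have "coprime (ord x) (ord z)"
    proof (rule ccontr)
      assume "\<not> coprime (ord x) (ord z)"
      then obtain q where q: "prime q" "q dvd ord x" "q dvd ord z"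
        using prime_factor_nat[of "gcd (ord x) (ord z)"] by (auto simp: coprime_iff_gcd_eq_1)
      have "q = b"
      proof (rule ccontr)
        assume "q \<noteq> b"
        then have "rank x = rank z" by (rule rank_eq[OF xyz(1,3) q(1) _ q(2,3)])
        then show False using less by simp
      qed
      then have "rank y = 2"
        using rank_b[of x] rank_b[of z] q less by auto
      then have "b dvd ord y" by (rule rank_2)
      then show False
        using coprime_common_divisor[OF cop(1), of b] q \<open>q = b\<close> by (simp add: not_prime_unit)
    qed
    then show ?thesis using less by (simp add: le_def)
  qed
  obtain \<alpha> :: "'a \<Rightarrow> nat" where \<alpha>: "inj_on \<alpha> (carrier G)" "\<And>x. \<alpha> x > 0"
    "\<And>x y. x \<in> carrier G \<Longrightarrow> y \<in> carrier G \<Longrightarrow> \<alpha> x dvd \<alpha> y \<longleftrightarrow> le x y"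
    by (rule divisor_labelling_of_order[OF fin, of le])
      (rule le_refl, erule (1) le_antisym, erule (4) le_trans, blast intro: that)
  have "coprime (ord x) (ord y) \<longleftrightarrow> le x y \<or> le y x"
    if "x \<in> carrier G" "y \<in> carrier G" "x \<noteq> y" for x y
    using rank_neq[OF that] that(3) by (auto simp: le_def coprime_commute)
  with \<alpha> show ?thesis
    unfolding divisor_graph_coprime_graph_iff by auto
qed

text \<open>
  Suitable powers \<open>u\<close>, \<open>v\<close>, \<open>w\<close> of the given elements have orders \<open>p\<close>, \<open>q\<close>, \<open>r\<close> and form a triangle.
  The element of order \<open>q * r\<close> is adjacent to \<open>u\<close> alone among these three, and similarly for the other
  two corners. The three pendant vertices force each corner label either to divide both other corner
  labels or to be divisible by both, which a chain of three distinct labels does not allow for its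
  middle term.
\<close>

theorem not_divisor_graph_if_prime_graph_triangle:
  fixes G :: "('a, 'b) monoid_scheme" and p q r :: nat
  assumes G: "group G"
    and primes: "prime p" "prime q" "prime r" and neq: "p \<noteq> q" "p \<noteq> r" "q \<noteq> r"
    and x: "x \<in> carrier G" "group.ord G x = p * q"
    and y: "y \<in> carrier G" "group.ord G y = p * r"
    and z: "z \<in> carrier G" "group.ord G z = q * r"
  shows "\<not> divisor_graph (coprime_graph G)"
proof
  interpret group G by fact
  assume "divisor_graph (coprime_graph G)"
  then obtain \<alpha> :: "'a \<Rightarrow> nat" where inj: "inj_on \<alpha> (carrier G)"
    and adj: "\<And>u v. u \<in> carrier G \<Longrightarrow> v \<in> carrier G \<Longrightarrow> u \<noteq> v \<Longrightarrow>
      coprime (ord u) (ord v) \<longleftrightarrow> \<alpha> u dvd \<alpha> v \<or> \<alpha> v dvd \<alpha> u"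
    unfolding divisor_graph_coprime_graph_iff by blast
  have gt1: "p > 1" "q > 1" "r > 1" using primes by (simp_all only: prime_gt_1_nat)
  define u where "u = x [^]\<^bsub>G\<^esub> q"
  define v where "v = x [^]\<^bsub>G\<^esub> p"
  define w where "w = y [^]\<^bsub>G\<^esub> p"
  have mem: "u \<in> carrier G" "v \<in> carrier G" "w \<in> carrier G"
    using x y by (auto simp: u_def v_def w_def)
  have ords: "ord u = p" "ord v = q" "ord w = r"
    using x y gt1 by (simp_all add: u_def v_def w_def ord_pow)
  have cop: "coprime p q" "coprime p r" "coprime q r"
    using primes neq by (simp_all add: primes_coprime)
  have ncop: "\<not> coprime p (p * s)" "\<not> coprime q (q * s)" "\<not> coprime r (r * s)"
    "\<not> coprime q (s * q)" "\<not> coprime r (s * r)" for s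
    using gt1 by auto
  \<comment> \<open>If \<open>k\<close> and \<open>l\<close> are non-adjacent neighbours of \<open>t\<close>, then \<open>t\<close> lies below both or above both:
    otherwise transitivity of divisibility would join \<open>k\<close> and \<open>l\<close>.\<close>
  have same_side: "\<alpha> t dvd \<alpha> k \<longleftrightarrow> \<alpha> t dvd \<alpha> l"
    if "t \<in> carrier G" "k \<in> carrier G" "l \<in> carrier G" "coprime (ord t) (ord k)"
      "coprime (ord t) (ord l)" "\<not> coprime (ord k) (ord l)" "ord t \<noteq> ord k" "ord t \<noteq> ord l"
      "ord k \<noteq> ord l" for t k l
  proof -
    have "t \<noteq> k" "t \<noteq> l" "k \<noteq> l" using that by auto
    then show ?thesis
      using adj[of t k] adj[of t l] adj[of k l] that by (meson dvd_trans)
  qed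
  have neq_prod: "p \<noteq> q * r" "q \<noteq> p * r" "r \<noteq> p * q"
    "p \<noteq> p * q" "q \<noteq> p * q" "p \<noteq> p * r" "r \<noteq> p * r" "q \<noteq> q * r" "r \<noteq> q * r"
    using cop gt1 ncop by (auto simp: coprime_mult_left_iff coprime_mult_right_iff)
  have u: "\<alpha> u dvd \<alpha> v \<longleftrightarrow> \<alpha> u dvd \<alpha> w"
    using same_side[of u v z] same_side[of u w z] mem z ords cop neq neq_prod ncop
    by (simp add: coprime_commute)
  have v: "\<alpha> v dvd \<alpha> u \<longleftrightarrow> \<alpha> v dvd \<alpha> w"
    using same_side[of v u y] same_side[of v w y] mem y ords cop neq neq_prod ncop
    by (simp add: coprime_commute)
  have w: "\<alpha> w dvd \<alpha> u \<longleftrightarrow> \<alpha> w dvd \<alpha> v"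
    using same_side[of w u x] same_side[of w v x] mem x ords cop neq neq_prod ncop
    by (simp add: coprime_commute)
  have one_way: "(\<alpha> k dvd \<alpha> l) \<noteq> (\<alpha> l dvd \<alpha> k)"
    if "k \<in> carrier G" "l \<in> carrier G" "coprime (ord k) (ord l)" "k \<noteq> l" for k l
    using adj[of k l] that inj by (auto dest: inj_onD dvd_antisym)
  have "u \<noteq> v" "u \<noteq> w" "v \<noteq> w" using ords neq by auto
  then show False
    using u v w one_way[of u v] one_way[of u w] one_way[of v w] mem ords cop by auto
qed


section \<open>Orders and cycle lengths of permutations\<close>

lemma sym_group_pow: "p [^]\<^bsub>sym_group n\<^esub> (k::nat) = p ^^ k"
  by (induction k) (simp_all add: nat_pow_def sym_group_one sym_group_mult funpow_swap1 fun_eq_iff)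

lemma alt_group_pow: "p [^]\<^bsub>alt_group n\<^esub> (k::nat) = p ^^ k"
  by (induction k) (simp_all add: nat_pow_def alt_group_one alt_group_mult funpow_swap1 fun_eq_iff)

lemma sym_group_ord_dvd_iff:
  assumes "p permutes {1..n}"
  shows "group.ord (sym_group n) p dvd k \<longleftrightarrow> p ^^ k = id"
  using group.pow_eq_id[OF sym_group_is_group, of p n k] assms
  by (simp add: sym_group_carrier sym_group_pow sym_group_one)

lemma alt_group_ord_eq:
  assumes "p \<in> carrier (alt_group n)"
  shows "group.ord (alt_group n) p = group.ord (sym_group n) p"
proof -
  have "group.ord (alt_group n) p dvd k \<longleftrightarrow> group.ord (sym_group n) p dvd k" for k
    using group.pow_eq_id[OF alt_group_is_group assms, of k] assms
    by (simp add: sym_group_ord_dvd_iff alt_group_carrier alt_group_pow alt_group_one)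
  then show ?thesis by (meson dvd_antisym dvd_refl)
qed

lemma finite_sym_group: "finite (carrier (sym_group n))"
  using finite_permutations[of "{1..n}"] by (simp add: sym_group_def)

lemma finite_alt_group: "finite (carrier (alt_group n))"
  by (rule finite_subset[OF _ finite_sym_group[of n]]) (auto simp: alt_group_carrier sym_group_carrier)

text \<open>
  Write the order as \<open>q * k\<close>. The \<open>k\<close>-th power of \<open>p\<close> is not the identity, so it moves some \<open>x\<close>; the
  length of the cycle through \<open>x\<close> divides \<open>q * k\<close> but not \<open>k\<close>, hence it is divisible by \<open>q\<close>.
\<close>

lemma prime_dvd_ord_imp_dvd_cycle_length:
  assumes p: "p permutes {1..n}" and q: "prime q" "q dvd group.ord (sym_group n) p"
  obtains x where "x \<in> {1..n}" "q dvd least_power p x"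
proof -
  let ?d = "group.ord (sym_group n) p"
  have perm: "permutation p" using p permutation_permutes by blast
  have "?d > 0"
    using group.ord_ge_1[OF sym_group_is_group finite_sym_group, of p n] p
    by (simp add: sym_group_carrier Suc_le_eq)
  define k where "k = ?d div q"
  have d: "?d = q * k" using q by (simp add: k_def)
  have "\<not> ?d dvd k"
    using d \<open>?d > 0\<close> prime_gt_1_nat[OF q(1)] by (auto dest: dvd_imp_le)
  then obtain x where x: "(p ^^ k) x \<noteq> x"
    using sym_group_ord_dvd_iff[OF p, of k] by (auto simp: fun_eq_iff)
  have "p x \<noteq> x"
  proof
    assume "p x = x"
    then have "(p ^^ k) x = x" by (induction k) auto
    then show False using x by simp
  qed
  then have "x \<in> {1..n}" using p unfolding permutes_def by blast
  moreover have "least_power p x dvd q * k" "\<not> least_power p x dvd k"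
    using x sym_group_ord_dvd_iff[OF p, of "q * k"] d by (auto simp: least_power_dvd[OF perm])
  then have "q dvd least_power p x"
    using q(1) by (metis coprime_commute coprime_dvd_mult_right_iff prime_imp_coprime)
  ultimately show thesis by (rule that)
qed

lemma card_cycle:
  assumes "permutation p"
  shows "card (set (support p x)) = least_power p x"
  using distinct_card[OF cycle_of_permutation[OF assms, of x]] by simp

lemma cycle_subset:
  assumes "p permutes S" "x \<in> S"
  shows "set (support p x) \<subseteq> S"
  using permutes_in_image[OF permutes_funpow[OF assms(1)]] assms(2) by auto

text \<open>
  The cycle whose length is divisible by \<open>q\<close> and the one whose length is divisible by \<open>r\<close> either
  coincide, so that their common length is divisible by \<open>q * r\<close>, or are disjoint and fit side by side
  into \<open>n\<close> points.
\<close>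

lemma two_primes_dvd_ord:
  assumes p: "p permutes {1..n}" and qr: "prime q" "prime r" "q \<noteq> r"
    "q dvd group.ord (sym_group n) p" "r dvd group.ord (sym_group n) p"
  shows "q * r \<le> n \<or>
    (\<exists>x \<in> {1..n}. \<exists>y \<in> {1..n}. q dvd least_power p x \<and> r dvd least_power p y \<and>
      set (support p x) \<inter> set (support p y) = {} \<and> least_power p x + least_power p y \<le> n)"
proof -
  have perm: "permutation p" using p permutation_permutes by blast
  obtain x where x: "x \<in> {1..n}" "q dvd least_power p x"
    using prime_dvd_ord_imp_dvd_cycle_length[OF p] qr by blast
  obtain y where y: "y \<in> {1..n}" "r dvd least_power p y"
    using prime_dvd_ord_imp_dvd_cycle_length[OF p] qr by blast
  let ?X = "set (support p x)" and ?Y = "set (support p y)"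
  have sub: "?X \<subseteq> {1..n}" "?Y \<subseteq> {1..n}" using cycle_subset[OF p] x y by auto
  show ?thesis
  proof (cases "?X \<inter> ?Y = {}")
    case True
    then have "card (?X \<union> ?Y) = least_power p x + least_power p y"
      by (simp only: card_Un_disjoint finite_set card_cycle[OF perm])
    moreover have "card (?X \<union> ?Y) \<le> n"
      using card_mono[of "{1..n}" "?X \<union> ?Y"] sub by (simp del: set_map)
    ultimately have "least_power p x + least_power p y \<le> n" by simp
    with x y True show ?thesis by blast
  next
    case False
    then have "?X = ?Y"
      using disjoint_support[OF perm] unfolding disjoint_def by blast
    then have "least_power p x = least_power p y" using card_cycle[OF perm] by metis
    then have "q * r dvd least_power p x"
      using x y qr by (simp add: divides_mult primes_coprime)
    moreover have "least_power p x > 0" by (rule least_power_of_permutation(2)[OF perm])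
    moreover have "least_power p x \<le> n"
      using card_mono[OF _ sub(1)] card_cycle[OF perm, of x] by simp
    ultimately have "q * r \<le> n" by (meson dvd_imp_le le_trans)
    then show ?thesis ..
  qed
qed

lemma add_primes_le_degree:
  assumes p: "p permutes {1..n}" and qr: "prime q" "prime r" "q \<noteq> r"
    "q dvd group.ord (sym_group n) p" "r dvd group.ord (sym_group n) p"
  shows "q + r \<le> n"
  using two_primes_dvd_ord[OF assms]
proof
  assume "q * r \<le> n"
  \<comment> \<open>For integers \<open>q, r \<ge> 2\<close> the product is at least the sum.\<close>
  obtain i j where ij: "q = i + 2" "r = j + 2"
    using prime_ge_2_nat[OF qr(1)] prime_ge_2_nat[OF qr(2)] by (metis add.commute le_Suc_ex)
  show ?thesis using \<open>q * r \<le> n\<close> unfolding ij by (simp add: algebra_simps)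
next
  assume "\<exists>x \<in> {1..n}. \<exists>y \<in> {1..n}. q dvd least_power p x \<and> r dvd least_power p y \<and>
      set (support p x) \<inter> set (support p y) = {} \<and> least_power p x + least_power p y \<le> n"
  then obtain x y where "q dvd least_power p x" "r dvd least_power p y"
    "least_power p x + least_power p y \<le> n" by blast
  moreover have "permutation p" using p permutation_permutes by blast
  ultimately show ?thesis
    using least_power_of_permutation(2)[of p] by (meson add_mono dvd_imp_le le_trans)
qed

lemma sign_cycle_of_list:
  "distinct cs \<Longrightarrow> sign (cycle_of_list cs) = (- 1) ^ (length cs - 1)"
proof (induction cs rule: cycle_of_list.induct)
  case (1 i j cs)
  have "sign (cycle_of_list (i # j # cs)) = sign (transpose i j) * sign (cycle_of_list (j # cs))"
    unfolding cycle_of_list.simps by (intro sign_compose permutation_swap_id permutation_of_cycle)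
  with 1 show ?case by (simp add: sign_swap_id del: cycle_of_list.simps)
qed (simp_all add: sign_id)

text \<open>
  One cycle of length \<open>10\<close> does not fit, so there are disjoint cycles of lengths divisible by \<open>5\<close> and
  by \<open>2\<close>. On eight points the lengths must be exactly \<open>5\<close> and \<open>2\<close>, and the at most one remaining
  point is fixed. The permutation is therefore the product of these two cycles, which is odd.
\<close>

lemma no_order_10_in_alt_group_8:
  assumes p: "p permutes {1..n}" and even: "evenperm p" and n: "n \<le> 8"
  shows "\<not> (2 dvd group.ord (sym_group n) p \<and> 5 dvd group.ord (sym_group n) p)"
proof
  assume "2 dvd group.ord (sym_group n) p \<and> 5 dvd group.ord (sym_group n) p"
  then obtain x y where xy: "x \<in> {1..n}" "y \<in> {1..n}" "5 dvd least_power p x" "2 dvd least_power p y"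
    and disj: "set (support p x) \<inter> set (support p y) = {}"
    and sum: "least_power p x + least_power p y \<le> n"
    using two_primes_dvd_ord[OF p, where q = 5 and r = 2] n by auto
  have perm: "permutation p" using p permutation_permutes by blast
  have pos: "least_power p x > 0" "least_power p y > 0"
    by (rule least_power_of_permutation(2)[OF perm])+
  from xy(3,4) obtain i j where ij: "least_power p x = 5 * i" "least_power p y = 2 * j"
    by (elim dvdE)
  with pos sum n have "i = 1" by linarith
  with ij pos sum n have "j = 1" by simp
  with ij \<open>i = 1\<close> have lx: "least_power p x = 5" and ly: "least_power p y = 2" by simp_all
  let ?X = "set (support p x)" and ?Y = "set (support p y)"
  let ?c = "cycle_of_list (support p x)" and ?d = "cycle_of_list (support p y)"
  have sub: "?X \<subseteq> {1..n}" "?Y \<subseteq> {1..n}" using cycle_subset[OF p] xy by auto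
  have "card ({1..n} - (?X \<union> ?Y)) = n - 7"
    using sub disj card_cycle[OF perm, of x] card_cycle[OF perm, of y] lx ly
    by (simp add: card_Diff_subset card_Un_disjoint del: set_map)
  then have rest: "card ({1..n} - (?X \<union> ?Y)) \<le> 1" using n by simp
  have c: "?c permutes ?X" and d: "?d permutes ?Y" by (rule cycle_permutes)+
  have "p z = (?c \<circ> ?d) z" for z
  proof -
    consider "z \<in> ?X" | "z \<in> ?Y" | "z \<notin> ?X \<union> ?Y" by blast
    then show ?thesis
    proof cases
      case 1
      then have "z \<notin> ?Y" using disj by blast
      then have "?d z = z" by (rule permutes_not_in[OF d])
      then show ?thesis using cycle_restrict[OF perm 1] by (simp only: o_apply)
    next
      case 2
      then have "?d z \<in> ?Y" by (simp only: permutes_in_image[OF d])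
      then have "?d z \<notin> ?X" using disj by blast
      then have "?c (?d z) = ?d z" by (rule permutes_not_in[OF c])
      then show ?thesis using cycle_restrict[OF perm 2] by (simp only: o_apply)
    next
      case 3
      have "p z = z"
      proof (cases "z \<in> {1..n}")
        case True
        have singleton: "s = t" if "finite R" "card R \<le> 1" "s \<in> R" "t \<in> R" for R and s t :: nat
          using that by (simp add: card_le_Suc0_iff_eq)
        have closed: "w \<in> set (support p s)" if "p w \<in> set (support p s)" for w s
        proof -
          have "w \<in> set (support p w)" using pos perm least_power_of_permutation(2)[OF perm, of w]
            by force
          moreover have "p w \<in> set (support p w)"
            unfolding support_set[OF perm] by (rule range_eqI[where x = 1]) simp
          then have "set (support p w) = set (support p s)"
            using that disjoint_support[OF perm] unfolding disjoint_def by blast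
          ultimately show ?thesis by blast
        qed
        have "p z \<notin> ?X \<union> ?Y" using 3 closed by blast
        moreover have "p z \<in> {1..n}" using True permutes_in_image[OF p] by blast
        ultimately have "p z \<in> {1..n} - (?X \<union> ?Y)" by blast
        moreover have "z \<in> {1..n} - (?X \<union> ?Y)" using 3 True by blast
        ultimately show ?thesis by (rule singleton[OF finite_Diff[OF finite_atLeastAtMost] rest])
      next
        case False
        then show ?thesis using p by (simp add: permutes_not_in)
      qed
      moreover have "?d z = z" "?c z = z"
        using 3 permutes_not_in[OF c, of z] permutes_not_in[OF d, of z] by blast+
      ultimately show ?thesis by (simp only: o_apply)
    qed
  qed
  then have "p = ?c \<circ> ?d" by blast
  then have "sign p = sign ?c * sign ?d"
    by (metis sign_compose permutation_of_cycle)
  also have "\<dots> = - 1"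
    using sign_cycle_of_list[OF cycle_of_permutation[OF perm], of x]
      sign_cycle_of_list[OF cycle_of_permutation[OF perm], of y] lx ly by simp
  finally show False using even by (simp add: sign_def)
qed


section \<open>Permutations with prescribed disjoint cycles\<close>

text \<open>
  The permutations needed as witnesses are given by their disjoint cycles, so that their orders and
  signs can be read off from the cycle lengths.
\<close>

primrec product_of_cycles :: "'a list list \<Rightarrow> 'a \<Rightarrow> 'a" where
  "product_of_cycles [] = id"
| "product_of_cycles (cs # css) = cycle_of_list cs \<circ> product_of_cycles css"

lemma product_of_cycles_permutes:
  "\<Union>(set ` set css) \<subseteq> S \<Longrightarrow> product_of_cycles css permutes S"
proof (induction css)
  case Nil
  show ?case unfolding product_of_cycles.simps by (rule permutes_id)
next
  case (Cons cs css)
  have "cycle_of_list cs permutes S"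
    using cycle_permutes permutes_subset Cons.prems by fastforce
  moreover have "product_of_cycles css permutes S" using Cons by simp
  ultimately show ?case
    unfolding product_of_cycles.simps by (rule permutes_compose[rotated])
qed

lemma sign_product_of_cycles:
  "\<forall>cs \<in> set css. distinct cs \<Longrightarrow>
    sign (product_of_cycles css) = (\<Prod>cs\<leftarrow>css. (- 1) ^ (length cs - 1))"
proof (induction css)
  case Nil
  then show ?case by (simp add: sign_id)
next
  case (Cons cs css)
  have "permutation (product_of_cycles css)"
    using product_of_cycles_permutes[OF subset_refl] by (auto simp: permutation_permutes)
  then have "sign (product_of_cycles (cs # css)) = sign (cycle_of_list cs) * sign (product_of_cycles css)"
    unfolding product_of_cycles.simps by (intro sign_compose permutation_of_cycle)
  with Cons show ?case by (simp add: sign_cycle_of_list del: product_of_cycles.simps)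
qed

lemma product_of_cycles_apply:
  assumes "distinct (concat css)" "cs \<in> set css" "x \<in> set cs"
  shows "product_of_cycles css x = cycle_of_list cs x"
  using assms
proof (induction css)
  case Nil
  then show ?case by simp
next
  case (Cons ds css)
  have supp: "product_of_cycles css y = y" if "y \<notin> \<Union>(set ` set css)" for y
    using product_of_cycles_permutes[OF subset_refl] that by (rule permutes_not_in)
  show ?case
  proof (cases "x \<in> set ds")
    case True
    then have "cs = ds" using Cons.prems by auto
    moreover have "x \<notin> \<Union>(set ` set css)" using True Cons.prems by auto
    ultimately show ?thesis using supp by simp
  next
    case False
    then have cs: "cs \<in> set css" using Cons.prems by auto
    then have "cycle_of_list cs x \<notin> set ds"
      using Cons.prems permutes_in_image[OF cycle_permutes, of cs x] by auto
    then show ?thesis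
      using Cons.IH cs Cons.prems by (simp add: id_outside_supp)
  qed
qed

text \<open>
  On the entries of one cycle the powers act by rotation; this is what determines the order.
\<close>

lemma product_of_cycles_funpow_nth:
  assumes "distinct (concat css)" "cs \<in> set css" "j < length cs"
  shows "(product_of_cycles css ^^ k) (cs ! j) = cs ! ((j + k) mod length cs)"
proof -
  have cs: "distinct cs" using assms(1,2) by (simp add: distinct_concat_iff)
  have "(product_of_cycles css ^^ k) (cs ! j) = (cycle_of_list cs ^^ k) (cs ! j)"
  proof (induction k)
    case (Suc k)
    have "(cycle_of_list cs ^^ k) (cs ! j) \<in> set cs"
      using permutes_in_image[OF permutes_funpow[OF cycle_permutes]] assms(3) by fastforce
    then show ?case using Suc product_of_cycles_apply[OF assms(1,2)] by simp
  qed simp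
  also have "\<dots> = map (cycle_of_list cs ^^ k) cs ! j" using assms(3) by simp
  also have "\<dots> = cs ! ((j + k) mod length cs)"
    using assms(3) by (simp add: cyclic_rotation[OF cs] nth_rotate add.commute)
  finally show ?thesis .
qed

lemma product_of_cycles_funpow_eq_id_iff:
  assumes "distinct (concat css)" "[] \<notin> set css"
  shows "product_of_cycles css ^^ k = id \<longleftrightarrow> (\<forall>cs \<in> set css. length cs dvd k)"
proof
  assume id: "product_of_cycles css ^^ k = id"
  show "\<forall>cs \<in> set css. length cs dvd k"
  proof
    fix cs assume cs: "cs \<in> set css"
    then have "length cs > 0" using assms(2) by auto
    moreover have "distinct cs" using assms(1) cs by (simp add: distinct_concat_iff)
    ultimately have "k mod length cs = 0"
      using product_of_cycles_funpow_nth[OF assms(1) cs, of 0 k] id by (simp add: nth_eq_iff_index_eq)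
    then show "length cs dvd k" by auto
  qed
next
  assume len: "\<forall>cs \<in> set css. length cs dvd k"
  have perm: "(product_of_cycles css ^^ k) permutes \<Union>(set ` set css)"
    by (rule permutes_funpow[OF product_of_cycles_permutes[OF subset_refl]])
  have "(product_of_cycles css ^^ k) x = x" for x
  proof (cases "x \<in> \<Union>(set ` set css)")
    case True
    then obtain cs j where cs: "cs \<in> set css" "j < length cs" "x = cs ! j"
      by (auto simp: in_set_conv_nth)
    then obtain m where "k = length cs * m" using len by auto
    with cs show ?thesis using product_of_cycles_funpow_nth[OF assms(1), of cs j k] by simp
  next
    case False
    then show ?thesis using perm by (simp add: permutes_not_in)
  qed
  then show "product_of_cycles css ^^ k = id" by auto
qed

lemma ord_product_of_cycles:
  assumes "distinct (concat css)" "[] \<notin> set css" "\<Union>(set ` set css) \<subseteq> {1..n}"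
  shows "group.ord (sym_group n) (product_of_cycles css) = Lcm (length ` set css)"
proof (rule dvd_antisym)
  note dvd_iff = sym_group_ord_dvd_iff[OF product_of_cycles_permutes[OF assms(3)]]
    product_of_cycles_funpow_eq_id_iff[OF assms(1,2)]
  show "group.ord (sym_group n) (product_of_cycles css) dvd Lcm (length ` set css)"
    by (simp add: dvd_iff dvd_Lcm)
  have "product_of_cycles css ^^ group.ord (sym_group n) (product_of_cycles css) = id"
    by (simp flip: dvd_iff(1))
  then show "Lcm (length ` set css) dvd group.ord (sym_group n) (product_of_cycles css)"
    by (auto simp: dvd_iff(2) intro: Lcm_least)
qed


section \<open>Symmetric and alternating groups\<close>

lemma prime_pair_sum_le_8:
  fixes q r :: nat
  assumes "prime q" "prime r" "q \<noteq> r" "q + r \<le> 8"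
  shows "{q, r} = {2, 3} \<or> {q, r} = {2, 5} \<or> {q, r} = {3, 5}"
proof -
  have "q \<ge> 2" "r \<ge> 2" using assms prime_ge_2_nat by auto
  then have "q \<in> {2, 3, 4, 5, 6}" "r \<in> {2, 3, 4, 5, 6}" using assms(4) by auto
  moreover have "\<not> prime (4::nat)" "\<not> prime (6::nat)" by simp_all
  ultimately have "q \<in> {2, 3, 5}" "r \<in> {2, 3, 5}" using assms by auto
  then show ?thesis using assms(3) by auto
qed

lemma divisor_graph_sym_group_le_7:
  assumes "n \<le> 7"
  shows "divisor_graph (coprime_graph (sym_group n))"
proof (rule divisor_graph_if_prime_graph_path[OF sym_group_is_group finite_sym_group,
      where a = 3 and b = 2 and c = 5])
  fix x :: "nat \<Rightarrow> nat" and q r :: nat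
  assume x: "x \<in> carrier (sym_group n)" and qr: "prime q" "prime r" "q \<noteq> r"
    "q dvd group.ord (sym_group n) x" "r dvd group.ord (sym_group n) x"
  have sum: "q + r \<le> 7"
    using add_primes_le_degree[OF _ qr] x assms by (simp add: sym_group_carrier)
  then have "{q, r} \<noteq> {3, 5}" by (auto simp: doubleton_eq_iff)
  moreover have "{q, r} = {2, 3} \<or> {q, r} = {2, 5} \<or> {q, r} = {3, 5}"
    using sum by (intro prime_pair_sum_le_8[OF qr(1-3)]) simp
  moreover have "{2, 3} = {3, 2 :: nat}" by (rule insert_commute)
  ultimately show "{q, r} = {3, 2} \<or> {q, r} = {2, 5}" by argo
qed simp_all

lemma divisor_graph_alt_group_le_8:
  assumes "n \<le> 8"
  shows "divisor_graph (coprime_graph (alt_group n))"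
proof (rule divisor_graph_if_prime_graph_path[OF alt_group_is_group finite_alt_group,
      where a = 2 and b = 3 and c = 5])
  fix x :: "nat \<Rightarrow> nat" and q r :: nat
  assume x: "x \<in> carrier (alt_group n)" and qr: "prime q" "prime r" "q \<noteq> r"
    and "q dvd group.ord (alt_group n) x" "r dvd group.ord (alt_group n) x"
  then have dvd: "q dvd group.ord (sym_group n) x" "r dvd group.ord (sym_group n) x"
    by (simp_all add: alt_group_ord_eq)
  have perm: "x permutes {1..n}" "evenperm x" using x by (simp_all add: alt_group_carrier)
  have "q + r \<le> 8"
    using add_primes_le_degree[OF perm(1) qr dvd] assms by simp
  moreover have "{q, r} \<noteq> {2, 5}"
    using no_order_10_in_alt_group_8[OF perm assms] dvd by (auto simp: doubleton_eq_iff)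
  ultimately show "{q, r} = {2, 3} \<or> {q, r} = {3, 5}"
    using prime_pair_sum_le_8[OF qr] by blast
qed simp_all

lemma lcm_2_3_5: "lcm 3 2 = (6::nat)" "lcm 5 2 = (10::nat)" "lcm 5 3 = (15::nat)"
  by code_simp+

lemma not_divisor_graph_sym_group_ge_8:
  assumes "n \<ge> 8"
  shows "\<not> divisor_graph (coprime_graph (sym_group n))"
proof (rule not_divisor_graph_if_prime_graph_triangle[OF sym_group_is_group,
      where p = 2 and q = 3 and r = 5])
  let ?x = "product_of_cycles [[1, 2, 3], [4, 5]] :: nat \<Rightarrow> nat"
    and ?y = "product_of_cycles [[1, 2, 3, 4, 5], [6, 7]] :: nat \<Rightarrow> nat"
    and ?z = "product_of_cycles [[1, 2, 3, 4, 5], [6, 7, 8]] :: nat \<Rightarrow> nat"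
  show "?x \<in> carrier (sym_group n)" "?y \<in> carrier (sym_group n)" "?z \<in> carrier (sym_group n)"
    unfolding sym_group_carrier using assms by (intro product_of_cycles_permutes; simp)+
  show "group.ord (sym_group n) ?x = 2 * 3" "group.ord (sym_group n) ?y = 2 * 5"
    "group.ord (sym_group n) ?z = 3 * 5"
    using assms lcm_2_3_5
    by (simp_all add: ord_product_of_cycles del: product_of_cycles.simps)
      (simp_all add: eval_nat_numeral)
qed simp_all

text \<open>
  Elements of orders \<open>6\<close> and \<open>10\<close> become even by using two transpositions in place of one; this is
  why degree \<open>9 = 5 + 2 + 2\<close> is required.
\<close>

lemma not_divisor_graph_alt_group_ge_9:
  assumes "n \<ge> 9"
  shows "\<not> divisor_graph (coprime_graph (alt_group n))"
proof (rule not_divisor_graph_if_prime_graph_triangle[OF alt_group_is_group,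
      where p = 2 and q = 3 and r = 5])
  let ?x = "product_of_cycles [[1, 2, 3], [4, 5], [6, 7]] :: nat \<Rightarrow> nat"
    and ?y = "product_of_cycles [[1, 2, 3, 4, 5], [6, 7], [8, 9]] :: nat \<Rightarrow> nat"
    and ?z = "product_of_cycles [[1, 2, 3, 4, 5], [6, 7, 8]] :: nat \<Rightarrow> nat"
  have even: "evenperm p" if "sign p = 1" for p :: "nat \<Rightarrow> nat"
    using that by (simp add: sign_def split: if_splits)
  have "?x permutes {1..n}" "?y permutes {1..n}" "?z permutes {1..n}"
    using assms by (intro product_of_cycles_permutes; simp)+
  moreover have "evenperm ?x" "evenperm ?y" "evenperm ?z"
    by (intro even; simp add: sign_product_of_cycles del: product_of_cycles.simps)+
  ultimately show mem: "?x \<in> carrier (alt_group n)" "?y \<in> carrier (alt_group n)"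
    "?z \<in> carrier (alt_group n)"
    unfolding alt_group_carrier by blast+
  show "group.ord (alt_group n) ?x = 2 * 3" "group.ord (alt_group n) ?y = 2 * 5"
    "group.ord (alt_group n) ?z = 3 * 5"
    unfolding mem[THEN alt_group_ord_eq]
    using assms lcm_2_3_5
    by (simp_all add: ord_product_of_cycles del: product_of_cycles.simps)
      (simp_all add: eval_nat_numeral)
qed simp_all

theorem theorem7p1:
  fixes n :: nat
  assumes "n > 0"
  shows "(divisor_graph (coprime_graph (sym_group n)) \<longleftrightarrow> n \<le> 7) \<and>
         (divisor_graph (coprime_graph (alt_group n)) \<longleftrightarrow> n \<le> 8)"
  using divisor_graph_sym_group_le_7[of n] not_divisor_graph_sym_group_ge_8[of n]
    divisor_graph_alt_group_le_8[of n] not_divisor_graph_alt_group_ge_9[of n]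
  by linarith

end
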